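(* Let $H$ be a separable real Hilbert space, $A$ a self-adjoint, positive coercive operator on $H$, $V=D(A^{1/2})$ with norm $\|u\|=|A^{1/2}u|$, and let $C\in L(V,V')$ with $\|C\|_{L(V,V')}<1$. Consider the system $$u''+u'+Au+Cv=0,\qquad v''+Av+C^*u=0. \qquad (S)$$ Assume in addition that (a) $\ker C=\{0\}$, $H\subset C(V)$ and $C^{-1}\in L(H,V)$; (b) $V'\subset C(H)$ and $C^{-1}\in L(V',H)$ (in the sense made precise in the context); (c) $AC^{-1}-C^{-1}A\in L(H,H)$, meaning that the operator $AC^{-1}-C^{-1}A\in L(V,V')$ is bounded for the $H$-norm with values in $H$, and so extends to a bounded operator on $H$. Let $$H_0(u,v,w,z)=\tfrac12\left(\|u\|^2+\|v\|^2+|w|^2+|z|^2\right)+\langle Cv,u\rangle .$$ Then for every fixed $p>1$ there exists $\varepsilon_0>0$ such that for all $\varepsilon\in(0,\varepsilon_0)$ the quadratic form on $V\times V\times H\times H$ $$H_\varepsilon(u,v,w,z)=H_0(u,v,w,z)-\varepsilon(v,z)+p\varepsilon(u,w)+\frac{(p+1)\varepsilon}{2}\left[\langle AC^{-1}w,v\rangle-\langle C^{-1}Au,z\rangle\right]$$ is a strict Liapunov functional for $(S)$. In particular the semigroup generated by $(S)$ is exponentially damped in $V\times V\times H\times H$.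
   Context: $(\cdot,\cdot)$ and $|\cdot|$ are the inner product and norm of $H$. $H$ is identified with its dual, so $V\subset H=H'\subset V'$ with continuous dense embeddings; $\langle\cdot,\cdot\rangle$ denotes the $V',V$ duality (or the $H$ inner product when both arguments lie in $H$). $V'$ carries the dual norm of $\|\cdot\|$, and $A$ is also regarded as its extension in $L(V,V')$. The adjoint $C^*\in L(V,V')$ is defined by $\langle C^*u,v\rangle=\langle Cv,u\rangle$ for $u,v\in V$. Condition (b) means: the inverse $C^{-1}:C(V)\to V$ (well defined since $\ker C=\{0\}$) extends to an injective bounded linear operator from $V'$ to $H$, still denoted $C^{-1}$ (equivalently, $C$ extends to an injective linear map defined on $H$ whose range contains $V'$ and whose inverse restricted to $V'$ is bounded from $V'$ to $H$). Thus $C^{-1}Cv=v$ for $v\in V$, $AC^{-1}\in L(H,V')$ and $C^{-1}A\in L(V,H)$. Condition (c) means: there is $K\ge0$ such that for all $u\in V$, $AC^{-1}u-C^{-1}Au\in H$ and $|AC^{-1}u-C^{-1}Au|\le K|u|$. Let $\mathcal{H}=V\times V\times H\times H$. For each $U_0\in\mathcal{H}$ the solution of $(S)$ with initial data $U_0$ is the unique $U=(u,v,u',v')\in C(\mathbb{R}^+,\mathcal{H})\cap C^1(\mathbb{R}^+,H\times H\times V'\times V')$ with $U(0)=U_0$ satisfying $(S)$ in $V'$; the maps $T(t):U_0\mapsto U(t)$ form the semigroup generated by $(S)$. A continuous quadratic form $Q$ on $\mathcal{H}$ is a strict Liapunov functional for $(S)$ if $Q$ is bounded above and below by positive multiples of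 the squared norm $\|u\|^2+\|v\|^2+|w|^2+|z|^2$ and there is $\delta>0$ such that for every solution $t\mapsto Q(U(t))$ is $C^1$ on $\mathbb{R}^+$ with $\frac{d}{dt}Q(U(t))\le-\delta Q(U(t))$. The semigroup is exponentially damped in $\mathcal{H}$ if there are $M\ge1$, $\delta>0$ with $\|T(t)\|_{L(\mathcal{H})}\le Me^{-\delta t}$ for all $t\ge0$. *)

theory Defs
  imports "HOL-Analysis.Analysis"
begin

text \<open>
  An unbounded operator in a Hilbert space is given by its domain \<open>D\<close> together with a total
  function of which only the values on \<open>D\<close> matter.
\<close>

definition linear_operator :: "'h::real_inner set \<Rightarrow> ('h \<Rightarrow> 'h) \<Rightarrow> bool" where
  "linear_operator D A \<longleftrightarrow> subspace D \<and>
     (\<forall>x\<in>D. \<forall>y\<in>D. A (x + y) = A x + A y) \<and> (\<forall>x\<in>D. \<forall>r. A (r *\<^sub>R x) = r *\<^sub>R A x)"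

definition adjoint_graph :: "'h::real_inner set \<Rightarrow> ('h \<Rightarrow> 'h) \<Rightarrow> ('h \<times> 'h) set" where
  "adjoint_graph D A = {(y, z). \<forall>x\<in>D. inner (A x) y = inner x z}"

text \<open>Equality of graphs includes equality of the domains of the operator and of its adjoint.\<close>

definition self_adjoint :: "'h::real_inner set \<Rightarrow> ('h \<Rightarrow> 'h) \<Rightarrow> bool" where
  "self_adjoint D A \<longleftrightarrow> linear_operator D A \<and> closure D = UNIV \<and>
     adjoint_graph D A = (\<lambda>x. (x, A x)) ` D"

definition positive_coercive :: "'h::real_inner set \<Rightarrow> ('h \<Rightarrow> 'h) \<Rightarrow> bool" where
  "positive_coercive D A \<longleftrightarrow> (\<exists>c>0. \<forall>x\<in>D. inner (A x) x \<ge> c * (norm x)\<^sup>2)"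

text \<open>
  \<open>(DS, S)\<close> is the operator \<open>A\<^sup>1\<^sup>/\<^sup>2\<close>, the nonnegative self-adjoint operator whose square,
  domain included, is \<open>(DA, A)\<close>.
\<close>

definition is_square_root ::
    "'h::real_inner set \<Rightarrow> ('h \<Rightarrow> 'h) \<Rightarrow> 'h set \<Rightarrow> ('h \<Rightarrow> 'h) \<Rightarrow> bool" where
  "is_square_root DA A DS S \<longleftrightarrow> self_adjoint DS S \<and> (\<forall>x\<in>DS. inner (S x) x \<ge> 0) \<and>
     DA = {x\<in>DS. S x \<in> DS} \<and> (\<forall>x\<in>DA. A x = S (S x))"

text \<open>
  The space \<open>V = D(A\<^sup>1\<^sup>/\<^sup>2)\<close>, normed by \<open>|A\<^sup>1\<^sup>/\<^sup>2 u|\<close>, is a type \<open>'v\<close> of its own, identified with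
  the subset \<open>DS\<close> of \<open>H\<close> through the embedding \<open>i\<close>.  Its dual \<open>V'\<close> is the normed space
  \<open>'v \<Rightarrow>\<^sub>L real\<close>, the duality is application, and \<open>L(V,V')\<close> is \<open>'v \<Rightarrow>\<^sub>L ('v \<Rightarrow>\<^sub>L real)\<close>: for \<open>C\<close> in
  the latter, \<open>C v u\<close> is the value of the functional \<open>Cv\<close> at \<open>u\<close>.  No instance is lost: for given
  \<open>(DS, S)\<close> one may take \<open>'v\<close> to be \<open>'h\<close> and \<open>i\<close> the inverse of \<open>S\<close>.
\<close>

definition is_form_space ::
    "'h::real_inner set \<Rightarrow> ('h \<Rightarrow> 'h) \<Rightarrow> ('v::real_normed_vector \<Rightarrow> 'h) \<Rightarrow> bool" where
  "is_form_space DS S i \<longleftrightarrow> bounded_linear i \<and> inj i \<and> range i = DS \<and>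
     (\<forall>u. norm u = norm (S (i u)))"

text \<open>The embedding of \<open>H = H'\<close> into \<open>V'\<close>.\<close>

definition to_dual ::
    "('v::real_normed_vector \<Rightarrow> 'h::real_inner) \<Rightarrow> 'h \<Rightarrow> 'v \<Rightarrow>\<^sub>L real" where
  "to_dual i h = Blinfun (\<lambda>u. inner h (i u))"

text \<open>The extension of \<open>A\<close> to \<open>L(V,V')\<close>; see \<open>A_ext_extends\<close> below.\<close>

definition A_ext ::
    "('h::real_inner \<Rightarrow> 'h) \<Rightarrow> ('v::real_normed_vector \<Rightarrow> 'h) \<Rightarrow> 'v \<Rightarrow>\<^sub>L ('v \<Rightarrow>\<^sub>L real)" where
  "A_ext S i = Blinfun (\<lambda>u. Blinfun (\<lambda>v. inner (S (i u)) (S (i v))))"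

definition adj :: "('v::real_normed_vector \<Rightarrow>\<^sub>L ('v \<Rightarrow>\<^sub>L real)) \<Rightarrow> 'v \<Rightarrow>\<^sub>L ('v \<Rightarrow>\<^sub>L real)" where
  "adj C = Blinfun (\<lambda>u. Blinfun (\<lambda>v. C v u))"

lemma bounded_bilinear_Blinfun:
  assumes "bounded_bilinear (b :: 'a::real_normed_vector \<Rightarrow> 'b::real_normed_vector \<Rightarrow> real)"
  shows "blinfun_apply (blinfun_apply (Blinfun (\<lambda>u. Blinfun (b u))) u) v = b u v"
proof -
  interpret bounded_bilinear b by fact
  have *: "blinfun_apply (Blinfun (b u)) = b u" for u
    by (simp add: bounded_linear_right bounded_linear_Blinfun_apply)
  obtain K where K: "\<And>u v. norm (b u v) \<le> norm u * norm v * K" "0 \<le> K"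
    using nonneg_bounded by blast
  have "bounded_linear (\<lambda>u. Blinfun (b u))"
  proof (rule bounded_linear_intro[where K = K])
    show "norm (Blinfun (b u)) \<le> norm u * K" for u
      using K by (intro norm_blinfun_bound) (auto simp: * mult_ac)
  qed (auto intro!: blinfun_eqI simp: * add_left scaleR_left blinfun.add_left blinfun.scaleR_left)
  then show ?thesis
    by (simp add: bounded_linear_Blinfun_apply *)
qed

lemma to_dual_apply:
  "bounded_linear i \<Longrightarrow> blinfun_apply (to_dual i h) u = inner h (i u)"
  unfolding to_dual_def
  by (subst bounded_linear_Blinfun_apply) (auto intro: bounded_linear_inner_right_comp)

lemma adj_apply: "blinfun_apply (blinfun_apply (adj C) u) v = C v u"
  unfolding adj_def
  by (rule bounded_bilinear_Blinfun)
     (rule bounded_bilinear.flip,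
      rule bounded_bilinear.comp1[OF bounded_bilinear_blinfun_apply blinfun.bounded_linear_right])

lemma A_ext_apply:
  assumes "is_square_root DA A DS S" "is_form_space DS S i"
  shows "blinfun_apply (blinfun_apply (A_ext S i) u) v = inner (S (i u)) (S (i v))"
proof -
  interpret i: bounded_linear i using assms(2) by (simp add: is_form_space_def)
  have r: "i u \<in> DS" and n: "norm u = norm (S (i u))" for u
    using assms(2) by (auto simp: is_form_space_def)
  have "bounded_linear (\<lambda>u. S (i u))"
    using assms(1) r n
    by (intro bounded_linear_intro[where K = 1])
       (auto simp: is_square_root_def self_adjoint_def linear_operator_def i.add i.scaleR)
  then have "bounded_bilinear (\<lambda>u v. inner (S (i u)) (S (i v)))"
    by (intro bounded_bilinear.comp[OF bounded_bilinear_inner])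
  from bounded_bilinear_Blinfun[OF this] show ?thesis by (simp add: A_ext_def)
qed

lemma A_ext_extends:
  assumes "is_square_root DA A DS S" "is_form_space DS S i" "i u \<in> DA"
  shows "blinfun_apply (A_ext S i) u = to_dual i (A (i u))"
proof (rule blinfun_eqI)
  fix v
  have i: "bounded_linear i" "i v \<in> DS" using assms(2) by (auto simp: is_form_space_def)
  have u: "S (i u) \<in> DS" "A (i u) = S (S (i u))"
    using assms(1,3) by (auto simp: is_square_root_def)
  have "(i v, S (i v)) \<in> adjoint_graph DS S"
    using assms(1) i by (auto simp: is_square_root_def self_adjoint_def)
  then have "inner (S (S (i u))) (i v) = inner (S (i u)) (S (i v))"
    using u by (auto simp: adjoint_graph_def)
  then show "blinfun_apply (blinfun_apply (A_ext S i) u) v = blinfun_apply (to_dual i (A (i u))) v"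
    using A_ext_apply[OF assms(1,2)] u i by (simp add: to_dual_apply)
qed

text \<open>
  \<open>Cinv_H i C h\<close> is the element \<open>C\<^sup>-\<^sup>1 h\<close> of \<open>V\<close> for \<open>h\<close> in \<open>H\<close>; it is meaningful when \<open>C\<close> is
  injective and its range contains \<open>H\<close>.
\<close>

definition Cinv_H ::
    "('v::real_normed_vector \<Rightarrow> 'h::real_inner) \<Rightarrow> ('v \<Rightarrow>\<^sub>L ('v \<Rightarrow>\<^sub>L real)) \<Rightarrow> 'h \<Rightarrow> 'v" where
  "Cinv_H i C h = inv (blinfun_apply C) (to_dual i h)"

text \<open>
  The energy space \<open>V \<times> V \<times> H \<times> H\<close> is a product type; the norm of the library on products is the
  Hilbert one, whose square is the sum of the squares of the four norms.
\<close>

type_synonym ('v, 'h) energy = "'v \<times> 'v \<times> 'h \<times> 'h"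

type_synonym ('v, 'h) weak = "'h \<times> 'h \<times> ('v \<Rightarrow>\<^sub>L real) \<times> ('v \<Rightarrow>\<^sub>L real)"

definition to_weak ::
    "('v::real_normed_vector \<Rightarrow> 'h::real_inner) \<Rightarrow> ('v, 'h) energy \<Rightarrow> ('v, 'h) weak" where
  "to_weak i = (\<lambda>(u, v, w, z). (i u, i v, to_dual i w, to_dual i z))"

text \<open>
  The system as a first-order equation for \<open>(u, v, w, z) = (u, v, u', v')\<close>, the last two
  components being equations in \<open>V'\<close>.
\<close>

definition system_rhs ::
    "('h::real_inner \<Rightarrow> 'h) \<Rightarrow> ('v::real_normed_vector \<Rightarrow> 'h) \<Rightarrow> ('v \<Rightarrow>\<^sub>L ('v \<Rightarrow>\<^sub>L real)) \<Rightarrow>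
     ('v, 'h) energy \<Rightarrow> ('v, 'h) weak" where
  "system_rhs S i C = (\<lambda>(u, v, w, z).
     (w, z, - to_dual i w - A_ext S i u - C v, - A_ext S i v - adj C u))"

definition C1_halfline :: "(real \<Rightarrow> 'a::real_normed_vector) \<Rightarrow> (real \<Rightarrow> 'a) \<Rightarrow> bool" where
  "C1_halfline f f' \<longleftrightarrow> continuous_on {0..} f' \<and>
     (\<forall>t\<ge>0. (f has_vector_derivative f' t) (at t within {0..}))"

definition is_solution ::
    "('h::real_inner \<Rightarrow> 'h) \<Rightarrow> ('v::real_normed_vector \<Rightarrow> 'h) \<Rightarrow> ('v \<Rightarrow>\<^sub>L ('v \<Rightarrow>\<^sub>L real)) \<Rightarrow>
     (real \<Rightarrow> ('v, 'h) energy) \<Rightarrow> bool" where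
  "is_solution S i C U \<longleftrightarrow> continuous_on {0..} U \<and>
     C1_halfline (\<lambda>t. to_weak i (U t)) (\<lambda>t. system_rhs S i C (U t))"

definition continuous_quadratic_form :: "('a::real_normed_vector \<Rightarrow> real) \<Rightarrow> bool" where
  "continuous_quadratic_form Q \<longleftrightarrow> (\<exists>b. bounded_bilinear b \<and> (\<forall>x. Q x = b x x))"

definition strict_liapunov ::
    "('h::real_inner \<Rightarrow> 'h) \<Rightarrow> ('v::real_normed_vector \<Rightarrow> 'h) \<Rightarrow> ('v \<Rightarrow>\<^sub>L ('v \<Rightarrow>\<^sub>L real)) \<Rightarrow>
     (('v, 'h) energy \<Rightarrow> real) \<Rightarrow> bool" where
  "strict_liapunov S i C Q \<longleftrightarrow> continuous_quadratic_form Q \<and>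
     (\<exists>a>0. \<exists>b>0. \<forall>X. a * (norm X)\<^sup>2 \<le> Q X \<and> Q X \<le> b * (norm X)\<^sup>2) \<and>
     (\<exists>\<delta>>0. \<forall>U. is_solution S i C U \<longrightarrow>
        (\<exists>q'. C1_halfline (\<lambda>t. Q (U t)) q' \<and> (\<forall>t\<ge>0. q' t \<le> - \<delta> * Q (U t))))"

text \<open>
  Only the values \<open>T t\<close> for \<open>t \<ge> 0\<close> matter.  Uniqueness of solutions and linearity of the maps are
  not part of the definition.
\<close>

definition is_generated_semigroup ::
    "('h::real_inner \<Rightarrow> 'h) \<Rightarrow> ('v::real_normed_vector \<Rightarrow> 'h) \<Rightarrow> ('v \<Rightarrow>\<^sub>L ('v \<Rightarrow>\<^sub>L real)) \<Rightarrow>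
     (real \<Rightarrow> ('v, 'h) energy \<Rightarrow> ('v, 'h) energy) \<Rightarrow> bool" where
  "is_generated_semigroup S i C T \<longleftrightarrow>
     (\<forall>U0. T 0 U0 = U0 \<and> is_solution S i C (\<lambda>t. T t U0))"

definition exponentially_damped :: "(real \<Rightarrow> 'a::real_normed_vector \<Rightarrow> 'a) \<Rightarrow> bool" where
  "exponentially_damped T \<longleftrightarrow> (\<exists>M\<ge>1. \<exists>\<delta>>0. \<forall>t\<ge>0.
     bounded_linear (T t) \<and> onorm (T t) \<le> M * exp (- \<delta> * t))"

definition H0_form ::
    "('v::real_normed_vector \<Rightarrow>\<^sub>L ('v \<Rightarrow>\<^sub>L real)) \<Rightarrow> ('v, 'h::real_inner) energy \<Rightarrow> real" where
  "H0_form C = (\<lambda>(u, v, w, z).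
     1 / 2 * ((norm u)\<^sup>2 + (norm v)\<^sup>2 + (norm w)\<^sup>2 + (norm z)\<^sup>2) + C v u)"

text \<open>\<open>Cinv\<close> is the extension of \<open>C\<^sup>-\<^sup>1\<close> to an operator from \<open>V'\<close> to \<open>H\<close>.\<close>

definition Heps_form ::
    "('h::real_inner \<Rightarrow> 'h) \<Rightarrow> ('v::real_normed_vector \<Rightarrow> 'h) \<Rightarrow> ('v \<Rightarrow>\<^sub>L ('v \<Rightarrow>\<^sub>L real)) \<Rightarrow>
     (('v \<Rightarrow>\<^sub>L real) \<Rightarrow>\<^sub>L 'h) \<Rightarrow> real \<Rightarrow> real \<Rightarrow> ('v, 'h) energy \<Rightarrow> real" where
  "Heps_form S i C Cinv p \<epsilon> = (\<lambda>(u, v, w, z).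
     H0_form C (u, v, w, z) - \<epsilon> * inner (i v) z + p * \<epsilon> * inner (i u) w
     + (p + 1) * \<epsilon> / 2 * (A_ext S i (Cinv_H i C w) v - inner (Cinv (A_ext S i u)) z))"

end

theory Submission
  imports Defs
begin

text \<open>
  For a solution of class \<open>C\<^sup>1\<close> in the energy space, the energy \<open>H\<^sub>0\<close> has derivative \<open>- |w|\<^sup>2\<close>.
  The terms \<open>- (v, z)\<close> and \<open>p (u, w)\<close> produce \<open>- |z|\<^sup>2\<close> and \<open>- p \<parallel>u\<parallel>\<^sup>2\<close>, but also the bad term
  \<open>\<parallel>v\<parallel>\<^sup>2\<close>.  The derivative of the bracket \<open>\<langle>AC\<^sup>-\<^sup>1w, v\<rangle> - \<langle>C\<^sup>-\<^sup>1Au, z\<rangle>\<close> contains \<open>\<parallel>u\<parallel>\<^sup>2 - \<parallel>v\<parallel>\<^sup>2\<close>, and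
  what else it contains is bounded by \<open>|w| (\<parallel>v\<parallel> + |z|)\<close>: the terms \<open>\<langle>C\<^sup>-\<^sup>1Au, v\<rangle>\<close> in \<open>V\<close> cancel, and the
  second-order terms combine to the bounded commutator \<open>AC\<^sup>-\<^sup>1 - C\<^sup>-\<^sup>1A\<close> applied to \<open>w\<close>.  Since
  \<open>\<parallel>C\<parallel> < 1\<close> and \<open>p > 1\<close>, the form so obtained is negative definite up to a multiple of \<open>|w|\<^sup>2\<close>, which
  \<open>- |w|\<^sup>2\<close> absorbs when \<open>\<epsilon>\<close> is small.

  A general solution is only weak, and the commutator has to be evaluated at \<open>u' = w\<close> outside \<open>V\<close>.  Its
  Steklov averages are solutions of class \<open>C\<^sup>1\<close> in the energy space, and the identity for them passes to
  the limit because its right-hand side is a continuous quadratic form of the solution.  This needs no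
  generation theorem.
\<close>

subsection \<open>Antiderivatives in Hilbert spaces\<close>

text \<open>Riemann sums are linear combinations of values of \<open>f\<close>, so they lie in
  \<open>V\<close>, and over fine divisions they approximate the integral.\<close>

lemma has_integral_in_closed_subspace:
  fixes f :: "real \<Rightarrow> 'a::real_normed_vector"
  assumes "(f has_integral y) {a..b}" "subspace V" "closed V" "\<And>x. x \<in> {a..b} \<Longrightarrow> f x \<in> V"
  shows "y \<in> V"
proof -
  have "y \<in> closure V"
  proof (rule iffD2[OF closure_approachable], intro allI impI)
    fix e :: real assume "e > 0"
    then obtain \<gamma> where "gauge \<gamma>"
      and \<gamma>: "\<And>D. D tagged_division_of {a..b} \<Longrightarrow> \<gamma> fine D \<Longrightarrow>
        norm (sum (\<lambda>(x,k). measure lborel k *\<^sub>R f x) D - y) < e"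
      using assms(1) unfolding has_integral_real by metis
    then obtain D where D: "D tagged_division_of {a..b}" "\<gamma> fine D"
      using fine_division_exists_real by blast
    have "sum (\<lambda>(x,k). measure lborel k *\<^sub>R f x) D \<in> V"
      using D(1) assms(4) by (intro subspace_sum[OF assms(2)])
        (auto intro!: subspace_scale[OF assms(2)] dest: tag_in_interval)
    then show "\<exists>z\<in>V. dist z y < e"
      using \<gamma>[OF D] by (auto simp: dist_norm)
  qed
  then show ?thesis using assms(3) by simp
qed

text \<open>
  The library integrates only functions with values in the class \<open>banach\<close>, to which the sort
  \<open>{real_inner, complete_space}\<close> does not belong.  So we integrate in the dual space, into which
  \<open>'a\<close> embeds isometrically with closed range.
\<close>

lemma continuous_has_antiderivative_Icc:
  fixes f :: "real \<Rightarrow> 'a::{real_inner, complete_space}"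
  assumes "continuous_on {a..b} f"
  obtains F where "\<And>t. t \<in> {a..b} \<Longrightarrow> (F has_vector_derivative f t) (at t within {a..b})"
proof -
  define J where "J = (blinfun_inner_right :: 'a \<Rightarrow> 'a \<Rightarrow>\<^sub>L real)"
  have J: "bounded_linear J" unfolding J_def by (rule bounded_linear_blinfun_inner_right)
  interpret J: bounded_linear J by (rule J)
  have normJ: "norm (J x) = norm x" for x
  proof (rule antisym)
    show "norm (J x) \<le> norm x"
      unfolding J_def by (rule norm_blinfun_bound) (auto simp: Cauchy_Schwarz_ineq2)
    have "norm x * norm x \<le> norm (J x) * norm x"
      using norm_blinfun[of "J x" x] by (simp add: J_def power2_norm_eq_inner flip: power2_eq_square)
    then show "norm x \<le> norm (J x)" by (cases "x = 0") auto
  qed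
  \<comment> \<open>An isometric image of a complete space is complete, hence closed. So the
    integral in the dual stays in the range of \<open>J\<close> and can be pulled back.\<close>
  have "complete (range J)"
    by (rule complete_isometric_image[OF zero_less_one subspace_UNIV J])
       (auto simp: normJ complete_UNIV)
  then have cl: "closed (range J)" by (rule complete_imp_closed)
  have sub: "subspace (range J)"
    using J.linear subspace_UNIV by (rule linear_subspace_image)
  have contJ: "continuous_on {a..b} (\<lambda>t. J (f t))"
    by (rule J.continuous_on[OF assms])
  define G where "G = (\<lambda>t. integral {a..t} (\<lambda>t. J (f t)))"
  have "G t \<in> range J" if "t \<in> {a..b}" for t
    unfolding G_def
  proof (rule has_integral_in_closed_subspace[OF integrable_integral sub cl])
    show "(\<lambda>t. J (f t)) integrable_on {a..t}"
      using that by (intro integrable_continuous_real continuous_on_subset[OF contJ]) auto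
  qed auto
  then have G: "J (inv J (G t)) = G t" if "t \<in> {a..b}" for t
    using that by (simp add: f_inv_into_f)
  show ?thesis
  proof (rule that[of "\<lambda>t. inv J (G t)"])
    fix t assume t: "t \<in> {a..b}"
    have "(G has_vector_derivative J (f t)) (at t within {a..b})"
      unfolding G_def by (rule integral_has_vector_derivative[OF contJ t])
    then have "((\<lambda>s. J (inv J (G s))) has_vector_derivative J (f t)) (at t within {a..b})"
      by (rule has_vector_derivative_transform[OF t, rotated]) (simp add: G)
    then have "((\<lambda>s. J ((1 / norm (s - t)) *\<^sub>R (inv J (G s) - (inv J (G t) + (s - t) *\<^sub>R f t)))) \<longlongrightarrow> 0)
        (at t within {a..b})"
      by (simp add: has_vector_derivative_def has_derivative_within J.diff J.add J.scaleR)
    \<comment> \<open>\<open>J\<close> preserves norms, so the remainder quotients tend to 0 because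
      their images do.\<close>
    then have "((\<lambda>s. (1 / norm (s - t)) *\<^sub>R (inv J (G s) - (inv J (G t) + (s - t) *\<^sub>R f t))) \<longlongrightarrow> 0)
        (at t within {a..b})"
      by (subst (asm) tendsto_norm_zero_iff[symmetric], unfold normJ) (rule tendsto_norm_zero_cancel)
    then show "((\<lambda>t. inv J (G t)) has_vector_derivative f t) (at t within {a..b})"
      by (simp add: has_vector_derivative_def has_derivative_within bounded_linear_scaleR_left)
  qed
qed

subsection \<open>Quadratic forms along weak solutions\<close>

text \<open>For \<open>Q x = b x x\<close> this is \<open>b X Y + b Y X\<close>, the derivative of
  \<open>Q\<close> at \<open>X\<close> in the direction \<open>Y\<close>. This form does not depend
  on a choice of \<open>b\<close>.\<close>

definition quadratic_polar :: "('a::real_vector \<Rightarrow> real) \<Rightarrow> 'a \<Rightarrow> 'a \<Rightarrow> real" where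
  "quadratic_polar Q X Y = Q (X + Y) - Q X - Q Y"

lemma uniform_limit_quadratic_form:
  assumes "continuous_quadratic_form Q" "uniform_limit S f g F" "bounded (g ` S)"
  shows "uniform_limit S (\<lambda>n x. Q (f n x)) (\<lambda>x. Q (g x)) F"
  using assms by (auto simp: continuous_quadratic_form_def intro: bounded_bilinear.bounded_uniform_limit)

lemma quadratic_form_has_vector_derivative:
  assumes "continuous_quadratic_form Q" "(f has_vector_derivative f') (at t within S)"
  shows "((\<lambda>t. Q (f t)) has_vector_derivative quadratic_polar Q (f t) f') (at t within S)"
proof -
  obtain b where b: "bounded_bilinear b" "\<And>x. Q x = b x x"
    using assms(1) by (auto simp: continuous_quadratic_form_def)
  interpret bounded_bilinear b by (rule b)
  show ?thesis
    using has_vector_derivative[OF assms(2) assms(2)]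
    by (simp add: b(2) quadratic_polar_def add_left add_right add.commute)
qed

text \<open>
  For a weak solution \<open>U\<close>, the Steklov average of \<open>U\<close> over \<open>[t, t + h]\<close> is a solution of
  class \<open>C\<^sup>1\<close> in the strong space, where the chain rule applies.
\<close>

lemma steklov_average:
  fixes U :: "real \<Rightarrow> 'e::{real_inner, complete_space}"
    and J L :: "'e \<Rightarrow> 'w::real_normed_vector"
  assumes J: "bounded_linear J" and L: "bounded_linear L"
    and U: "continuous_on {0..T + 1} U"
    and JU: "\<And>t. t \<in> {0..T + 1} \<Longrightarrow> ((\<lambda>t. J (U t)) has_vector_derivative L (U t)) (at t within {0..T + 1})"
  obtains G G' where
    "\<And>n t. t \<in> {0..T} \<Longrightarrow> (G n has_vector_derivative G' n t) (at t within {0..T})"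
    "\<And>n t. t \<in> {0..T} \<Longrightarrow> J (G' n t) = L (G n t)"
    "uniform_limit {0..T} G U sequentially"
proof -
  interpret J: bounded_linear J by (rule J)
  interpret L: bounded_linear L by (rule L)
  obtain F where F: "\<And>t. t \<in> {0..T+1} \<Longrightarrow> (F has_vector_derivative U t) (at t within {0..T+1})"
    using continuous_has_antiderivative_Icc[OF U] by blast
  define h :: "nat \<Rightarrow> real" where "h n = inverse (real (Suc n))" for n
  have h: "0 < h n" "h n \<le> 1" for n
    by (auto simp: h_def field_simps)
  \<comment> \<open>The average of \<open>U\<close>, written through the antiderivative, so that its
    derivative is a difference quotient of \<open>U\<close> and lies in the strong space. As
    \<open>h n \<le> 1\<close>, only times up to \<open>T + 1\<close> enter.\<close>
  define G where "G = (\<lambda>n t. (F (t + h n) - F t) /\<^sub>R h n)"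
  define G' where "G' = (\<lambda>n t. (U (t + h n) - U t) /\<^sub>R h n)"
  \<comment> \<open>The integrated form of the equation. Subtracting it at \<open>t\<close> from it
    at \<open>t + h n\<close> gives \<open>J (G' n t) = L (G n t)\<close>.\<close>
  have "\<exists>c. \<forall>t\<in>{0..T+1}. J (U t) - L (F t) = c"
  proof (rule has_derivative_zero_constant)
    fix t assume "t \<in> {0..T+1}"
    then have "((\<lambda>t. J (U t) - L (F t)) has_vector_derivative L (U t) - L (U t)) (at t within {0..T+1})"
      by (intro has_vector_derivative_diff JU L.has_vector_derivative F)
    then show "((\<lambda>t. J (U t) - L (F t)) has_derivative (\<lambda>h. 0)) (at t within {0..T+1})"
      by (simp add: has_vector_derivative_def)
  qed simp
  then obtain c where c: "\<And>t. t \<in> {0..T+1} \<Longrightarrow> J (U t) = L (F t) + c"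
    by (metis add.commute diff_add_cancel)
  show ?thesis
  proof
    fix n t assume t: "t \<in> {0..T}"
    have sh: "((\<lambda>t. F (t + h n)) has_vector_derivative U (t + h n)) (at t within {0..T})"
    proof -
      have "(F has_vector_derivative U (t + h n)) (at (t + h n) within (\<lambda>t. t + h n) ` {0..T})"
        using t h[of n] by (intro has_vector_derivative_within_subset[OF F]) auto
      moreover have "((\<lambda>t. t + h n) has_real_derivative 1) (at t within {0..T})"
        by (auto intro!: derivative_eq_intros)
      ultimately have "((F \<circ> (\<lambda>t. t + h n)) has_vector_derivative 1 *\<^sub>R U (t + h n)) (at t within {0..T})"
        by (intro vector_diff_chain_within) (simp_all add: has_real_derivative_iff_has_vector_derivative)
      then show ?thesis by (simp add: o_def)
    qed
    have "(F has_vector_derivative U t) (at t within {0..T})"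
      using t by (intro has_vector_derivative_within_subset[OF F]) auto
    with sh show "(G n has_vector_derivative G' n t) (at t within {0..T})"
      unfolding G_def G'_def
      by (intro bounded_linear.has_vector_derivative[OF bounded_linear_scaleR_right]
            has_vector_derivative_diff)
    show "J (G' n t) = L (G n t)"
      using t h[of n] c[of t] c[of "t + h n"]
      by (simp add: G_def G'_def J.scaleR J.diff L.scaleR L.diff)
  next
    show "uniform_limit {0..T} G U sequentially"
    proof (rule uniform_limitI)
      fix e :: real assume e: "e > 0"
      have "uniformly_continuous_on {0..T+1} U"
        using U by (simp add: compact_uniformly_continuous)
      then obtain d where d: "d > 0"
        "\<And>s t. s \<in> {0..T+1} \<Longrightarrow> t \<in> {0..T+1} \<Longrightarrow> dist s t < d \<Longrightarrow> dist (U s) (U t) < e / 2"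
        using e unfolding uniformly_continuous_on_def by (metis half_gt_zero)
      have "h \<longlonglongrightarrow> 0" unfolding h_def by (rule LIMSEQ_inverse_real_of_nat)
      then have "\<forall>\<^sub>F n in sequentially. h n < d" using d(1) by (rule order_tendstoD)
      then show "\<forall>\<^sub>F n in sequentially. \<forall>t\<in>{0..T}. dist (G n t) (U t) < e"
      proof (eventually_elim, intro ballI)
        fix n t assume n: "h n < d" and t: "t \<in> {0..T}"
        \<comment> \<open>Mean value estimate: the derivative \<open>U\<close> of \<open>F\<close>
          stays within \<open>e / 2\<close> of \<open>U t\<close> on the short interval, uniformly
          in \<open>t\<close>.\<close>
        have "norm (F (t + h n) - F t - (t + h n - t) *\<^sub>R U t) \<le> norm (t + h n - t) * (e / 2)"
        proof (rule vector_differentiable_bound_linearization[where S = "{t..t + h n}"])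
          show "(F has_vector_derivative U x) (at x within {t..t + h n})" if "x \<in> {t..t + h n}" for x
            using that t h[of n] by (intro has_vector_derivative_within_subset[OF F]) auto
          show "norm (U x - U t) \<le> e / 2" if "x \<in> {t..t + h n}" for x
            using d(2)[of x t] that t h[of n] n by (auto simp: dist_norm)
        qed (use h[of n] in \<open>auto simp: closed_segment_eq_real_ivl\<close>)
        also have "F (t + h n) - F t - (t + h n - t) *\<^sub>R U t = h n *\<^sub>R (G n t - U t)"
          using h(1)[of n] by (simp add: G_def scaleR_right_diff_distrib)
        finally have "norm (G n t - U t) \<le> e / 2"
          using h(1)[of n] by simp
        then show "dist (G n t) (U t) < e"
          using e by (simp add: dist_norm)
      qed
    qed
  qed
qed

text \<open>The derivative of \<open>U\<close> exists only in the weak space, so \<open>QR\<close>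
  is applied to the averages \<open>G n\<close> instead. Then \<open>Q (G n t)\<close> has the
  derivative \<open>R (G n t)\<close>. The derivatives converge uniformly on bounded intervals, so
  differentiation passes to the limit.\<close>

lemma weak_solution_quadratic_form_derivative:
  fixes U :: "real \<Rightarrow> 'e::{real_inner, complete_space}"
    and J L :: "'e \<Rightarrow> 'w::real_normed_vector"
  assumes J: "bounded_linear J" and L: "bounded_linear L"
    and U: "continuous_on {0..} U"
    and JU: "\<And>t. 0 \<le> t \<Longrightarrow> ((\<lambda>t. J (U t)) has_vector_derivative L (U t)) (at t within {0..})"
    and Q: "continuous_quadratic_form Q" and R: "continuous_quadratic_form R"
    and QR: "\<And>X Y. J Y = L X \<Longrightarrow> quadratic_polar Q X Y = R X"
    and t: "0 \<le> t"
  shows "((\<lambda>t. Q (U t)) has_vector_derivative R (U t)) (at t within {0..})"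
proof -
  \<comment> \<open>One extra unit of time keeps \<open>t\<close> away from the right end, so
    derivatives within \<open>{0..T}\<close> and within \<open>{0..}\<close> agree at
    \<open>t\<close>.\<close>
  define T where "T = t + 1"
  have T: "0 \<le> T" "t \<in> {0..T}" "t < T" using t by (auto simp: T_def)
  obtain G G' where G:
    "\<And>n t. t \<in> {0..T} \<Longrightarrow> (G n has_vector_derivative G' n t) (at t within {0..T})"
    "\<And>n t. t \<in> {0..T} \<Longrightarrow> J (G' n t) = L (G n t)"
    and lim: "uniform_limit {0..T} G U sequentially"
  proof (rule steklov_average[OF J L])
    show "continuous_on {0..T + 1} U" by (rule continuous_on_subset[OF U]) auto
    show "((\<lambda>t. J (U t)) has_vector_derivative L (U t)) (at t within {0..T + 1})"
      if "t \<in> {0..T + 1}" for t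
      using that by (intro has_vector_derivative_within_subset[OF JU]) auto
  qed blast
  have bdd: "bounded (U ` {0..T})"
    by (intro compact_imp_bounded compact_continuous_image continuous_on_subset[OF U]) auto
  have limQ: "(\<lambda>n. Q (G n x)) \<longlonglongrightarrow> Q (U x)" if "x \<in> {0..T}" for x
    using uniform_limit_quadratic_form[OF Q lim bdd] that by (rule tendsto_uniform_limitI)
  have "\<exists>g. \<forall>x\<in>{0..T}. (\<lambda>n. Q (G n x)) \<longlonglongrightarrow> g x \<and>
      (g has_derivative (\<lambda>h. h *\<^sub>R R (U x))) (at x within {0..T})"
  proof (rule has_derivative_sequence)
    show "((\<lambda>x. Q (G n x)) has_derivative (\<lambda>h. h *\<^sub>R R (G n x))) (at x within {0..T})"
      if "x \<in> {0..T}" for n x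
      using quadratic_form_has_vector_derivative[OF Q G(1)[OF that, of n]] QR[OF G(2)[OF that, of n]]
      by (simp add: has_vector_derivative_def)
    show "\<forall>\<^sub>F n in sequentially. \<forall>x\<in>{0..T}. \<forall>h. norm (h *\<^sub>R R (G n x) - h *\<^sub>R R (U x)) \<le> e * norm h"
      if "e > 0" for e
      using uniform_limitD[OF uniform_limit_quadratic_form[OF R lim bdd] that]
    proof eventually_elim
      case (elim n)
      then show ?case
        by (auto simp: dist_norm abs_mult mult.commute[of e] intro!: mult_left_mono
            simp flip: right_diff_distrib intro: less_imp_le)
    qed
    show "(\<lambda>n. Q (G n t)) \<longlonglongrightarrow> Q (U t)" by (rule limQ[OF T(2)])
  qed (use T in auto)
  then obtain g where g: "\<And>x. x \<in> {0..T} \<Longrightarrow> (\<lambda>n. Q (G n x)) \<longlonglongrightarrow> g x"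
      "(g has_derivative (\<lambda>h. h *\<^sub>R R (U t))) (at t within {0..T})"
    using T(2) by blast
  have "g x = Q (U x)" if "x \<in> {0..T}" for x
    using g(1)[OF that] limQ[OF that] by (rule LIMSEQ_unique)
  then have "((\<lambda>x. Q (U x)) has_vector_derivative R (U t)) (at t within {0..T})"
    unfolding has_vector_derivative_def
    by (intro has_derivative_transform[OF T(2) _ g(2)]) simp
  moreover have "at t within {0..T} = at t within {0..}"
    using T by (intro at_within_nhd[of _ "{..<T}"]) auto
  ultimately show ?thesis by simp
qed

subsection \<open>Extension from a dense range\<close>

text \<open>The bound makes \<open>f u\<close> a Lipschitz function of \<open>i u\<close>. It
  extends by uniform continuity, and linearity and the bound survive the limit. This turns the
  commutator, given on \<open>V\<close>, into an operator on \<open>H\<close>.\<close>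

lemma extend_from_dense_range:
  fixes i :: "'v::real_normed_vector \<Rightarrow> 'h::real_normed_vector"
    and f :: "'v \<Rightarrow> 'k::{real_normed_vector, complete_space}"
  assumes i: "linear i" and dense: "closure (range i) = UNIV"
    and f: "linear f" and le: "\<And>u. norm (f u) \<le> K * norm (i u)"
  obtains B where "bounded_linear B" "\<And>u. B (i u) = f u"
proof -
  interpret i: linear i by (rule i)
  interpret f: linear f by (rule f)
  \<comment> \<open>\<open>inv i\<close> picks some preimage; \<open>dist_le\<close> shows that the
    value of \<open>f\<close> does not depend on which.\<close>
  define g where "g x = f (inv i x)" for x
  have dist_le: "norm (f u - f v) \<le> K * norm (i u - i v)" for u v
    using le[of "u - v"] by (simp add: f.diff i.diff)
  have "i u = i v \<Longrightarrow> f u = f v" for u v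
    using dist_le[of u v] by simp
  then have gi: "g (i u) = f u" for u
    unfolding g_def by (metis f_inv_into_f rangeI)
  \<comment> \<open>A Lipschitz constant is nonnegative, and no sign of \<open>K\<close> is
    assumed.\<close>
  have "(max K 0)-lipschitz_on (range i) g"
  proof (rule lipschitz_onI)
    fix x y assume "x \<in> range i" "y \<in> range i"
    then obtain u v where "x = i u" "y = i v" by blast
    then show "dist (g x) (g y) \<le> max K 0 * dist x y"
      using dist_le[of u v] mult_right_mono[of K "max K 0" "norm (i u - i v)"]
      by (simp add: gi dist_norm)
  qed simp
  then have "uniformly_continuous_on (range i) g"
    by (rule lipschitz_on_uniformly_continuous)
  then obtain B where B: "uniformly_continuous_on (closure (range i)) B"
      "\<And>x. x \<in> range i \<Longrightarrow> g x = B x"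
    using uniformly_continuous_on_extension_on_closure by metis
  have Bi: "B (i u) = f u" for u
    using B(2)[of "i u"] gi by simp
  have cont: "isCont B x" for x
    using uniformly_continuous_imp_continuous[OF B(1)]
    by (simp add: dense continuous_on_eq_continuous_at)
  have approx: "\<exists>u. (\<lambda>n. i (u n)) \<longlonglongrightarrow> x \<and> (\<lambda>n. f (u n)) \<longlonglongrightarrow> B x" for x
  proof -
    obtain y where y: "\<And>n. y n \<in> range i" "y \<longlonglongrightarrow> x"
      using dense by (metis UNIV_I closure_sequential)
    then have "\<forall>n. \<exists>v. y n = i v" by blast
    then obtain u where u: "y = (\<lambda>n. i (u n))" by metis
    then have "(\<lambda>n. B (i (u n))) \<longlonglongrightarrow> B x"
      using isCont_tendsto_compose[OF cont y(2)] by simp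
    then show ?thesis using y u by (auto simp: Bi)
  qed
  have "bounded_linear B"
  proof (rule bounded_linear_intro[where K = K])
    fix x y :: 'h and r :: real
    obtain u where u: "(\<lambda>n. i (u n)) \<longlonglongrightarrow> x" "(\<lambda>n. f (u n)) \<longlonglongrightarrow> B x" using approx by blast
    obtain v where v: "(\<lambda>n. i (v n)) \<longlonglongrightarrow> y" "(\<lambda>n. f (v n)) \<longlonglongrightarrow> B y" using approx by blast
    have "(\<lambda>n. B (i (u n + v n))) \<longlonglongrightarrow> B (x + y)"
      unfolding i.add by (intro isCont_tendsto_compose[OF cont] tendsto_add u v)
    moreover have "(\<lambda>n. B (i (u n + v n))) \<longlonglongrightarrow> B x + B y"
      unfolding Bi f.add by (intro tendsto_add u v)
    ultimately show "B (x + y) = B x + B y" by (rule LIMSEQ_unique)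
    have "(\<lambda>n. B (i (r *\<^sub>R u n))) \<longlonglongrightarrow> B (r *\<^sub>R x)"
      unfolding i.scaleR by (intro isCont_tendsto_compose[OF cont] tendsto_intros u)
    moreover have "(\<lambda>n. B (i (r *\<^sub>R u n))) \<longlonglongrightarrow> r *\<^sub>R B x"
      unfolding Bi f.scaleR by (intro tendsto_intros u)
    ultimately show "B (r *\<^sub>R x) = r *\<^sub>R B x" by (rule LIMSEQ_unique)
    have "(\<lambda>n. norm (f (u n))) \<longlonglongrightarrow> norm (B x)" "(\<lambda>n. K * norm (i (u n))) \<longlonglongrightarrow> K * norm x"
      by (intro tendsto_intros u)+
    then show "norm (B x) \<le> norm x * K"
      using le by (subst mult.commute) (blast intro: LIMSEQ_le)
  qed
  then show ?thesis using Bi that by blast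
qed

subsection \<open>Calculus of quadratic forms\<close>

lemma continuous_quadratic_form_bilinear:
  assumes "bounded_bilinear b" "bounded_linear f" "bounded_linear g"
  shows "continuous_quadratic_form (\<lambda>x. b (f x) (g x))"
  unfolding continuous_quadratic_form_def
  by (rule exI[of _ "\<lambda>x y. b (f x) (g y)"]) (simp add: bounded_bilinear.comp[OF assms])

lemma continuous_quadratic_form_scaleR:
  assumes "continuous_quadratic_form Q"
  shows "continuous_quadratic_form (\<lambda>x. c * Q x)"
proof -
  obtain b where b: "bounded_bilinear b" "\<And>x. Q x = b x x"
    using assms by (auto simp: continuous_quadratic_form_def)
  have "bounded_bilinear (\<lambda>x y. b (c *\<^sub>R x) y)"
    by (rule bounded_bilinear.comp1[OF b(1)]) (rule bounded_linear_scaleR_right)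
  then show ?thesis
    unfolding continuous_quadratic_form_def
    by (intro exI[of _ "\<lambda>x y. b (c *\<^sub>R x) y"])
      (simp add: b(2) bounded_bilinear.scaleR_left[OF b(1)])
qed

lemma continuous_quadratic_form_add:
  assumes "continuous_quadratic_form P" "continuous_quadratic_form Q"
  shows "continuous_quadratic_form (\<lambda>x. P x + Q x)"
proof -
  obtain b c where bc: "bounded_bilinear b" "\<And>x. P x = b x x" "bounded_bilinear c" "\<And>x. Q x = c x x"
    using assms by (auto simp: continuous_quadratic_form_def)
  have "bounded_bilinear (\<lambda>x y. b x y + c x y)"
  proof -
    interpret b: bounded_bilinear b by (rule bc)
    interpret c: bounded_bilinear c by (rule bc)
    obtain K L where "\<And>x y. norm (b x y) \<le> norm x * norm y * K" "\<And>x y. norm (c x y) \<le> norm x * norm y * L"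
      using b.bounded c.bounded by blast
    then have "norm (b x y + c x y) \<le> norm x * norm y * (K + L)" for x y
      by (metis add_mono distrib_left norm_triangle_le)
    then have "\<exists>K. \<forall>x y. norm (b x y + c x y) \<le> norm x * norm y * K" by blast
    then show ?thesis
      by unfold_locales
        (simp_all add: b.add_left b.add_right c.add_left c.add_right b.scaleR_left b.scaleR_right
          c.scaleR_left c.scaleR_right distrib_left)
  qed
  then show ?thesis
    unfolding continuous_quadratic_form_def
    by (intro exI[of _ "\<lambda>x y. b x y + c x y"]) (simp add: bc)
qed

lemma continuous_quadratic_form_diff:
  assumes "continuous_quadratic_form P" "continuous_quadratic_form Q"
  shows "continuous_quadratic_form (\<lambda>x. P x - Q x)"
  using continuous_quadratic_form_add[OF assms(1) continuous_quadratic_form_scaleR[OF assms(2), of "-1"]]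
  by simp

lemmas continuous_quadratic_form_intros =
  continuous_quadratic_form_add continuous_quadratic_form_diff continuous_quadratic_form_scaleR
  continuous_quadratic_form_bilinear[OF bounded_bilinear_inner]
  continuous_quadratic_form_bilinear[OF bounded_bilinear_blinfun_apply]

lemma continuous_quadratic_form_bound:
  assumes "continuous_quadratic_form Q"
  obtains M where "0 \<le> M" "\<And>x. \<bar>Q x\<bar> \<le> M * (norm x)\<^sup>2"
proof -
  obtain b where b: "bounded_bilinear b" "\<And>x. Q x = b x x"
    using assms by (auto simp: continuous_quadratic_form_def)
  obtain M where "0 \<le> M" "\<And>x y. norm (b x y) \<le> norm x * norm y * M"
    using bounded_bilinear.nonneg_bounded[OF b(1)] by blast
  then show ?thesis
    using that[of M] b(2) by (simp add: power2_eq_square mult.commute)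
qed

lemma continuous_quadratic_form_continuous_on:
  assumes "continuous_quadratic_form Q" "continuous_on S f"
  shows "continuous_on S (\<lambda>x. Q (f x))"
  using assms by (auto simp: continuous_quadratic_form_def intro: bounded_bilinear.continuous_on)

text \<open>Gronwall argument: \<open>exp (\<delta> * t) * q t\<close> is continuous up to the ends
  and has a nonpositive derivative inside.\<close>

lemma exponential_decay:
  fixes q q' :: "real \<Rightarrow> real"
  assumes q: "\<And>t. 0 \<le> t \<Longrightarrow> (q has_vector_derivative q' t) (at t within {0..})"
    and le: "\<And>t. 0 \<le> t \<Longrightarrow> q' t \<le> - \<delta> * q t" and "0 \<le> t"
  shows "q t \<le> q 0 * exp (- \<delta> * t)"
proof -
  have "exp (\<delta> * t) * q t \<le> exp (\<delta> * 0) * q 0"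
  proof (rule DERIV_nonpos_imp_decreasing_open[OF \<open>0 \<le> t\<close>])
    fix x assume x: "0 < x" "x < t"
    have "(q has_real_derivative q' x) (at x)"
      using q[of x] x at_within_interior[of x "{0..}"]
      by (simp add: has_real_derivative_iff_has_vector_derivative)
    then have "((\<lambda>x. exp (\<delta> * x) * q x) has_real_derivative exp (\<delta> * x) * (\<delta> * q x + q' x)) (at x)"
      by (auto intro!: derivative_eq_intros simp: algebra_simps)
    moreover have "exp (\<delta> * x) * (\<delta> * q x + q' x) \<le> 0"
      using le[of x] x by (intro mult_nonneg_nonpos) auto
    ultimately show "\<exists>y. ((\<lambda>x. exp (\<delta> * x) * q x) has_real_derivative y) (at x) \<and> y \<le> 0"
      by blast
  next
    have "continuous_on {0..} q"
      unfolding continuous_on_eq_continuous_within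
      using q by (auto intro: has_vector_derivative_continuous)
    then show "continuous_on {0..t} (\<lambda>x. exp (\<delta> * x) * q x)"
      by (intro continuous_intros) (auto intro: continuous_on_subset)
  qed
  then show ?thesis
    by (simp add: exp_minus field_simps)
qed

subsection \<open>The Liapunov functional\<close>

lemma bounded_linear_to_dual:
  assumes "bounded_linear (i :: 'v::real_normed_vector \<Rightarrow> 'h::real_inner)"
  shows "bounded_linear (to_dual i)"
proof -
  obtain K where K: "0 \<le> K" "\<And>u. norm (i u) \<le> norm u * K"
    using bounded_linear.nonneg_bounded[OF assms] by blast
  show ?thesis
  proof (rule bounded_linear_intro[where K = K])
    fix h
    have "\<bar>inner h (i u)\<bar> \<le> norm h * K * norm u" for u
      using order_trans[OF Cauchy_Schwarz_ineq2[of h "i u"] mult_left_mono[OF K(2)[of u], of "norm h"]]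
      by (simp add: mult_ac)
    then show "norm (to_dual i h) \<le> norm h * K"
      using K(1) by (intro norm_blinfun_bound) (auto simp: to_dual_apply[OF assms])
  qed (auto intro!: blinfun_eqI simp: to_dual_apply[OF assms] inner_add_left blinfun.bilinear_simps)
qed

text \<open>The difference \<open>h - k\<close> is orthogonal to the range of \<open>i\<close>,
  which is dense. Identities in \<open>H\<close> may thus be checked in \<open>V'\<close>.\<close>

lemma to_dual_inj:
  assumes "bounded_linear (i :: 'v::real_normed_vector \<Rightarrow> 'h::real_inner)"
    and "closure (range i) = UNIV" and "to_dual i h = to_dual i k"
  shows "h = k"
proof -
  have "closed {x. inner (h - k) x = 0}" by (intro closed_Collect_eq continuous_intros)
  moreover have "range i \<subseteq> {x. inner (h - k) x = 0}"
    using assms(3) by (auto simp: inner_diff_left simp flip: to_dual_apply[OF assms(1)])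
  ultimately have "closure (range i) \<subseteq> {x. inner (h - k) x = 0}" by (rule closure_minimal[rotated])
  then have "h - k \<in> {x. inner (h - k) x = 0}" using assms(2) by blast
  then show ?thesis by simp
qed

text \<open>Expand the square of \<open>\<mu> * y - k * x\<close>. Used with
  \<open>x = norm w\<close>, it charges only \<open>\<mu> / 2\<close> to the other variable.\<close>

lemma Young:
  fixes k \<mu> x y :: real
  assumes "\<mu> > 0"
  shows "k * x * y \<le> \<mu> / 2 * y\<^sup>2 + k\<^sup>2 / (2 * \<mu>) * x\<^sup>2"
proof -
  have "0 \<le> (\<mu> * y - k * x)\<^sup>2 / (2 * \<mu>)" using assms by simp
  also have "\<dots> = \<mu> / 2 * y\<^sup>2 + k\<^sup>2 / (2 * \<mu>) * x\<^sup>2 - k * x * y"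
    using assms by (simp add: field_simps power2_eq_square)
  finally show ?thesis by simp
qed

text \<open>The consequences of the hypotheses on which the computation rests. \<open>A_ext\<close>
  is the Riesz map of \<open>V\<close>, \<open>Cinv_H\<close> a right inverse of \<open>C\<close> on
  \<open>H\<close>, \<open>Cinv\<close> a left inverse of \<open>C\<close>, and \<open>B\<close> the
  extension of the commutator to \<open>H\<close>, whose identity is stated after testing with
  \<open>v\<close>.\<close>

locale coupled_system =
  fixes S :: "'h::{real_inner, complete_space} \<Rightarrow> 'h"
    and i :: "'v::{real_inner, complete_space} \<Rightarrow> 'h"
    and C :: "'v \<Rightarrow>\<^sub>L ('v \<Rightarrow>\<^sub>L real)"
    and Cinv :: "('v \<Rightarrow>\<^sub>L real) \<Rightarrow>\<^sub>L 'h"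
    and B :: "'h \<Rightarrow> 'h"
  assumes bounded_linear_i: "bounded_linear i"
    and A_ext_inner: "\<And>u v. A_ext S i u v = inner u v"
    and norm_C: "norm C < 1"
    and bounded_linear_Cinv_H: "bounded_linear (Cinv_H i C)"
    and C_Cinv_H: "\<And>h. C (Cinv_H i C h) = to_dual i h"
    and Cinv_C: "\<And>v. Cinv (C v) = i v"
    and bounded_linear_B: "bounded_linear B"
    and commutator: "\<And>u v. A_ext S i (Cinv_H i C (i u)) v - inner (Cinv (A_ext S i u)) (i v) = inner (B (i u)) (i v)"
begin

section \<open>The energy, its perturbation and the rate: continuity and bounds\<close>

lemma C_bound: "\<bar>C v u\<bar> \<le> norm C * ((norm u)\<^sup>2 + (norm v)\<^sup>2) / 2"
proof -
  have "\<bar>C v u\<bar> \<le> norm (C v) * norm u"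
    using norm_blinfun[of "C v" u] by simp
  also have "\<dots> \<le> norm C * norm v * norm u"
    by (intro mult_right_mono norm_blinfun) simp
  also have "\<dots> = norm C * (norm v * norm u)"
    by simp
  also have "\<dots> \<le> norm C * (((norm u)\<^sup>2 + (norm v)\<^sup>2) / 2)"
    using sum_squares_bound[of "norm v" "norm u"] by (intro mult_left_mono) auto
  finally show ?thesis by simp
qed

lemma norm_energy: "(norm (u :: 'v, v :: 'v, w :: 'h, z :: 'h))\<^sup>2 =
    (norm u)\<^sup>2 + (norm v)\<^sup>2 + (norm w)\<^sup>2 + (norm z)\<^sup>2"
  by (simp add: norm_Pair)

text \<open>The factor of \<epsilon> in \<open>Heps_form\<close>, with the duality of
  \<open>A_ext S i (Cinv_H i C w)\<close> and \<open>v\<close> rewritten as the inner product of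
  \<open>V\<close>.\<close>

definition perturbation :: "real \<Rightarrow> ('v, 'h) energy \<Rightarrow> real" where
  "perturbation p = (\<lambda>(u, v, w, z). p * inner (i u) w - inner (i v) z
     + (p + 1) / 2 * (inner (Cinv_H i C w) v - inner (Cinv (A_ext S i u)) z))"

text \<open>
  Along the solutions, \<open>H\<^sub>\<epsilon>\<close> has the derivative \<open>- |w|\<^sup>2 + \<epsilon> * rate p (u, v, w, z)\<close>; the
  coefficient \<open>(p + 1) / 2\<close> makes those of \<open>|u|\<^sup>2\<close> and \<open>|v|\<^sup>2\<close> in it equal.
\<close>

definition rate :: "real \<Rightarrow> ('v, 'h) energy \<Rightarrow> real" where
  "rate p = (\<lambda>(u, v, w, z). p * inner w w - inner z z - (p - 1) / 2 * (inner u u + inner v v)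
     - (p - 1) * C v u - p * inner w (i u)
     - (p + 1) / 2 * (inner (Cinv_H i C w) v - inner (B w) z))"

lemma Heps_form_eq: "Heps_form S i C Cinv p \<epsilon> X = H0_form C X + \<epsilon> * perturbation p X"
  by (cases X) (simp add: Heps_form_def perturbation_def A_ext_inner algebra_simps)

lemmas bounded_linear_energy_intros = bounded_linear_fst_comp bounded_linear_snd_comp
  bounded_linear_ident bounded_linear_compose[OF bounded_linear_i]
  bounded_linear_compose[OF bounded_linear_Cinv_H] bounded_linear_compose[OF bounded_linear_B]
  bounded_linear_compose[OF blinfun.bounded_linear_right]

lemma continuous_quadratic_form_H0: "continuous_quadratic_form (H0_form C)"
  unfolding H0_form_def case_prod_beta power2_norm_eq_inner
  by (intro continuous_quadratic_form_intros bounded_linear_energy_intros)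

lemma continuous_quadratic_form_perturbation: "continuous_quadratic_form (perturbation p)"
  unfolding perturbation_def case_prod_beta
  by (intro continuous_quadratic_form_intros bounded_linear_energy_intros)

lemma continuous_quadratic_form_rate: "continuous_quadratic_form (rate p)"
  unfolding rate_def case_prod_beta
  by (intro continuous_quadratic_form_intros bounded_linear_energy_intros)

text \<open>By \<open>C_bound\<close> the coupling changes the potential energy by at most the
  fraction \<open>norm C < 1\<close> of it.\<close>

lemma H0_form_bounds:
  fixes X :: "('v, 'h) energy"
  shows "(1 - norm C) / 2 * (norm X)\<^sup>2 \<le> H0_form C X" "H0_form C X \<le> (norm X)\<^sup>2"
proof -
  obtain u v w z where X: "X = (u, v, w, z)" by (cases X) auto
  have "H0_form C X - (1 - norm C) / 2 * (norm X)\<^sup>2 =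
      norm C * ((norm w)\<^sup>2 + (norm z)\<^sup>2) / 2 + (norm C * ((norm u)\<^sup>2 + (norm v)\<^sup>2) / 2 + C v u)"
    unfolding X norm_energy H0_form_def by (simp add: field_simps)
  moreover have "0 \<le> norm C * ((norm w)\<^sup>2 + (norm z)\<^sup>2) / 2" by simp
  ultimately show "(1 - norm C) / 2 * (norm X)\<^sup>2 \<le> H0_form C X"
    using C_bound[of v u] by linarith
  have "norm C * ((norm u)\<^sup>2 + (norm v)\<^sup>2) \<le> 1 * ((norm u)\<^sup>2 + (norm v)\<^sup>2)"
    using norm_C by (intro mult_right_mono) auto
  moreover have "2 * C v u \<le> norm C * ((norm u)\<^sup>2 + (norm v)\<^sup>2)"
    using C_bound[of v u] by simp
  ultimately have "2 * C v u \<le> (norm u)\<^sup>2 + (norm v)\<^sup>2"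
    by simp
  moreover have "2 * H0_form C X = (norm u)\<^sup>2 + (norm v)\<^sup>2 + (norm w)\<^sup>2 + (norm z)\<^sup>2 + 2 * C v u"
    by (simp add: X H0_form_def)
  ultimately show "H0_form C X \<le> (norm X)\<^sup>2"
    unfolding X norm_energy using zero_le_power2[of "norm w"] zero_le_power2[of "norm z"] by linarith
qed

text \<open>The part of \<open>rate p\<close> free of \<open>w\<close> is negative definite because
  \<open>norm C < 1 < p\<close>. Every mixed term has a factor \<open>w\<close> and is split by
  \<open>Young\<close> at the cost of a multiple of |w|^2.\<close>

lemma rate_bound:
  assumes "p > 1"
  obtains N c where "0 < c" "0 \<le> N"
    "\<And>u v w z. rate p (u, v, w, z) \<le> N * inner w w - c * ((norm u)\<^sup>2 + (norm v)\<^sup>2 + (norm z)\<^sup>2)"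
proof -
  \<comment> \<open>\<open>m\<close> is what remains of the coefficient \<open>(p - 1) / 2\<close>
    after \<open>C v u\<close> is absorbed. The minimum with 1 makes \<open>\<mu>\<close> serve for
    |z|^2 too.\<close>
  define m where "m = (p - 1) * (1 - norm C) / 2"
  define \<mu> where "\<mu> = min 1 m"
  have "m > 0" using assms norm_C by (simp add: m_def)
  then have \<mu>: "0 < \<mu>" "\<mu> \<le> 1" "\<mu> \<le> m" by (auto simp: \<mu>_def)
  obtain Ki where Ki: "0 \<le> Ki" "\<And>u. norm (i u) \<le> norm u * Ki"
    using bounded_linear.nonneg_bounded[OF bounded_linear_i] by blast
  obtain Kc where Kc: "0 \<le> Kc" "\<And>u. norm (Cinv_H i C u) \<le> norm u * Kc"
    using bounded_linear.nonneg_bounded[OF bounded_linear_Cinv_H] by blast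
  obtain Kb where Kb: "0 \<le> Kb" "\<And>u. norm (B u) \<le> norm u * Kb"
    using bounded_linear.nonneg_bounded[OF bounded_linear_B] by blast
  define k where "k = p * Ki + (p + 1) / 2 * (Kc + Kb)"
  have k: "p * Ki \<le> k" "(p + 1) / 2 * Kc \<le> k" "(p + 1) / 2 * Kb \<le> k"
    using assms Ki(1) Kc(1) Kb(1) by (auto simp: k_def distrib_left)
  \<comment> \<open>\<open>p\<close> comes from \<open>p * inner w w\<close>, and each of the three
    mixed terms leaves one Young remainder. They also use up half of \<open>\<mu>\<close>, which
    leaves \<open>\<mu> / 2\<close>.\<close>
  define N where "N = p + 3 * (k\<^sup>2 / (2 * \<mu>))"
  show ?thesis
  proof (rule that[of "\<mu> / 2" N])
    show "0 < \<mu> / 2" "0 \<le> N" using \<mu> assms by (auto simp: N_def)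
    fix u v :: 'v and w z :: 'h
    have 1: "- (p * inner w (i u)) \<le> \<mu> / 2 * (norm u)\<^sup>2 + k\<^sup>2 / (2 * \<mu>) * (norm w)\<^sup>2"
    proof -
      have "- inner w (i u) \<le> norm w * (norm u * Ki)"
        using Cauchy_Schwarz_ineq2[of w "i u"] mult_left_mono[OF Ki(2)[of u], of "norm w"] by simp
      then have "p * (- inner w (i u)) \<le> p * (norm w * (norm u * Ki))"
        using assms by (intro mult_left_mono) auto
      also have "\<dots> = p * Ki * (norm w * norm u)" by simp
      also have "\<dots> \<le> k * (norm w * norm u)" using k by (intro mult_right_mono) auto
      finally show ?thesis using Young[OF \<mu>(1), of k "norm w" "norm u"] by (simp add: mult_ac)
    qed
    have 2: "- ((p + 1) / 2 * inner (Cinv_H i C w) v) \<le> \<mu> / 2 * (norm v)\<^sup>2 + k\<^sup>2 / (2 * \<mu>) * (norm w)\<^sup>2"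
    proof -
      have "- inner (Cinv_H i C w) v \<le> (norm w * Kc) * norm v"
        using Cauchy_Schwarz_ineq2[of "Cinv_H i C w" v] mult_right_mono[OF Kc(2)[of w], of "norm v"] by simp
      then have "(p + 1) / 2 * (- inner (Cinv_H i C w) v) \<le> (p + 1) / 2 * ((norm w * Kc) * norm v)"
        using assms by (intro mult_left_mono) auto
      also have "\<dots> = (p + 1) / 2 * Kc * (norm w * norm v)" by simp
      also have "\<dots> \<le> k * (norm w * norm v)" using k by (intro mult_right_mono) auto
      finally show ?thesis using Young[OF \<mu>(1), of k "norm w" "norm v"] by (simp add: mult_ac)
    qed
    have 3: "(p + 1) / 2 * inner (B w) z \<le> \<mu> / 2 * (norm z)\<^sup>2 + k\<^sup>2 / (2 * \<mu>) * (norm w)\<^sup>2"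
    proof -
      have "inner (B w) z \<le> (norm w * Kb) * norm z"
        using Cauchy_Schwarz_ineq2[of "B w" z] mult_right_mono[OF Kb(2)[of w], of "norm z"] by simp
      then have "(p + 1) / 2 * inner (B w) z \<le> (p + 1) / 2 * ((norm w * Kb) * norm z)"
        using assms by (intro mult_left_mono) auto
      also have "\<dots> = (p + 1) / 2 * Kb * (norm w * norm z)" by simp
      also have "\<dots> \<le> k * (norm w * norm z)" using k by (intro mult_right_mono) auto
      finally show ?thesis using Young[OF \<mu>(1), of k "norm w" "norm z"] by (simp add: mult_ac)
    qed
    have 4: "- ((p - 1) / 2 * ((norm u)\<^sup>2 + (norm v)\<^sup>2)) - (p - 1) * C v u \<le> - \<mu> * ((norm u)\<^sup>2 + (norm v)\<^sup>2)"
    proof -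
      have "(p - 1) * (- C v u) \<le> (p - 1) * (norm C * ((norm u)\<^sup>2 + (norm v)\<^sup>2) / 2)"
        using C_bound[of v u] assms by (intro mult_left_mono) auto
      moreover have "\<mu> * ((norm u)\<^sup>2 + (norm v)\<^sup>2) \<le> m * ((norm u)\<^sup>2 + (norm v)\<^sup>2)"
        using \<mu> by (intro mult_right_mono) auto
      ultimately show ?thesis by (simp add: m_def field_simps)
    qed
    have 5: "- (norm z)\<^sup>2 \<le> - \<mu> * (norm z)\<^sup>2"
      using \<mu> mult_right_mono[of \<mu> 1 "(norm z)\<^sup>2"] by simp
    have "rate p (u, v, w, z) = p * (norm w)\<^sup>2 - (norm z)\<^sup>2 - (p - 1) / 2 * ((norm u)\<^sup>2 + (norm v)\<^sup>2)
     - (p - 1) * C v u - p * inner w (i u)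
     - (p + 1) / 2 * inner (Cinv_H i C w) v + (p + 1) / 2 * inner (B w) z"
      by (simp add: rate_def power2_norm_eq_inner right_diff_distrib)
    also have "\<dots> \<le> p * (norm w)\<^sup>2 + 3 * (k\<^sup>2 / (2 * \<mu>) * (norm w)\<^sup>2)
        + (\<mu> / 2 * (norm u)\<^sup>2 + \<mu> / 2 * (norm v)\<^sup>2 + \<mu> / 2 * (norm z)\<^sup>2)
        - \<mu> * ((norm u)\<^sup>2 + (norm v)\<^sup>2) - \<mu> * (norm z)\<^sup>2"
      using 1 2 3 4 5 by linarith
    also have "\<dots> = N * inner w w - \<mu> / 2 * ((norm u)\<^sup>2 + (norm v)\<^sup>2 + (norm z)\<^sup>2)"
      by (simp add: N_def power2_norm_eq_inner[symmetric] algebra_simps)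
    finally show "rate p (u, v, w, z) \<le> N * inner w w - \<mu> / 2 * ((norm u)\<^sup>2 + (norm v)\<^sup>2 + (norm z)\<^sup>2)" .
  qed
qed

section \<open>The derivative of the functional along the system\<close>

lemma bounded_linear_to_weak: "bounded_linear (to_weak i)"
  unfolding to_weak_def case_prod_beta
  by (intro bounded_linear_Pair bounded_linear_energy_intros
      bounded_linear_compose[OF bounded_linear_to_dual[OF bounded_linear_i]])

lemma bounded_linear_system_rhs: "bounded_linear (system_rhs S i C)"
  unfolding system_rhs_def case_prod_beta
  by (intro bounded_linear_Pair bounded_linear_sub bounded_linear_minus bounded_linear_energy_intros
      bounded_linear_compose[OF bounded_linear_to_dual[OF bounded_linear_i]])

text \<open>\<open>Y\<close> stands for the time derivative at \<open>X\<close> of a solution that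
  is differentiable in the energy space. The cancellations turn an expression in \<open>X\<close>
  and \<open>Y\<close> into a continuous quadratic form of \<open>X\<close> alone.\<close>

lemma Heps_polar:
  assumes "to_weak i Y = system_rhs S i C X"
  shows "quadratic_polar (Heps_form S i C Cinv p \<epsilon>) X Y
    = - (case X of (u, v, w, z) \<Rightarrow> inner w w) + \<epsilon> * rate p X"
proof -
  interpret i: bounded_linear i by (rule bounded_linear_i)
  interpret c: bounded_linear "Cinv_H i C" by (rule bounded_linear_Cinv_H)
  note td = to_dual_apply[OF bounded_linear_i]
  obtain u v w z where X: "X = (u, v, w, z)" by (cases X) auto
  obtain u' v' w' z' where Y: "Y = (u', v', w', z')" by (cases Y) auto
  have w: "w = i u'" and z: "z = i v'"
    and W: "to_dual i w' = - to_dual i w - A_ext S i u - C v"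
    and Z: "to_dual i z' = - A_ext S i v - adj C u"
    using assms by (auto simp: X Y to_weak_def system_rhs_def)
  have w': "inner w' (i y) = - inner w (i y) - inner u y - C v y" for y
    using arg_cong[OF W, of "\<lambda>f. blinfun_apply f y"] by (simp add: td A_ext_inner blinfun.bilinear_simps)
  have z': "inner z' (i y) = - inner v y - C y u" for y
    using arg_cong[OF Z, of "\<lambda>f. blinfun_apply f y"]
    by (simp add: td A_ext_inner adj_apply blinfun.bilinear_simps)
  \<comment> \<open>The first equation, solved for \<open>A u\<close> and divided by
    \<open>C\<close>: \<open>A_ext S i u\<close> has the preimage \<open>y\<close> under
    \<open>C\<close>. So its image under \<open>Cinv\<close> comes from \<open>V\<close> and can be
    paired with \<open>z'\<close> through the second equation.\<close>
  define y where "y = - Cinv_H i C w' - Cinv_H i C w - v"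
  have Cy: "C y = A_ext S i u"
    using W by (simp add: y_def blinfun.bilinear_simps C_Cinv_H)
  have Cyu: "C y u = inner u u" by (simp add: Cy A_ext_inner)
  have CAu: "Cinv (A_ext S i u) = i y" by (simp add: Cinv_C flip: Cy)
  have Cw': "Cinv_H i C w' = - y - Cinv_H i C w - v" by (simp add: y_def)
  \<comment> \<open>The second-order terms: as \<open>w = i u'\<close> and \<open>z = i v'\<close>,
    the commutator identity on \<open>V\<close> applies to them.\<close>
  have B: "inner (Cinv_H i C w) v' = inner (Cinv (A_ext S i u')) z + inner (B w) z"
    using commutator[of u' v'] by (simp add: A_ext_inner w z)
  have ww: "inner w w = inner w (i u')" "inner z z = inner z (i v')" by (simp_all add: w z)
  have "quadratic_polar (H0_form C) X Y =
      inner u u' + inner v v' + inner w' (i u') + inner z' (i v') + C v u' + C v' u"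
    unfolding quadratic_polar_def X Y
    by (simp add: H0_form_def power2_norm_eq_inner inner_add_left inner_add_right
        blinfun.bilinear_simps inner_commute[of u' u] inner_commute[of v' v]
        inner_commute[of w w'] inner_commute[of z z'] flip: w z)
      (simp add: field_simps)
  \<comment> \<open>The equations tested with \<open>u'\<close> and \<open>v'\<close> cancel
    everything but the damping.\<close>
  also have "\<dots> = - inner w w"
    unfolding w' z' by (simp add: ww)
  finally have H0: "quadratic_polar (H0_form C) X Y = - inner w w" .
  have Pu: "inner (i (u + u')) (w + w') =
      inner (i u) w + inner (i u') w' + (inner w w - inner w (i u) - inner u u - C v u)"
    by (simp add: i.add inner_add_left inner_add_right inner_commute[of "i u" w'] w' flip: w)
  have Pv: "inner (i (v + v')) (z + z') =
      inner (i v) z + inner (i v') z' + (inner z z - inner v v - C v u)"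
    by (simp add: i.add inner_add_left inner_add_right inner_commute[of "i v" z'] z' flip: z)
  have Pc: "inner (Cinv_H i C (w + w')) (v + v') - inner (Cinv (A_ext S i (u + u'))) (z + z') =
      (inner (Cinv_H i C w) v - inner (Cinv (A_ext S i u)) z)
      + (inner (Cinv_H i C w') v' - inner (Cinv (A_ext S i u')) z')
      + (inner u u - inner v v - inner (Cinv_H i C w) v + inner (B w) z)"
  proof -
    \<comment> \<open>The term \<open>- inner v y\<close> occurs here and in the next identity, and
      drops out of their difference.\<close>
    have "inner (Cinv_H i C w') v = - inner v y - inner (Cinv_H i C w) v - inner v v"
      by (simp add: Cw' inner_diff_left inner_commute[of y])
    moreover have "inner (Cinv (A_ext S i u)) z' = - inner v y - inner u u"
      by (simp add: CAu inner_commute[of "i y"] z' Cyu)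
    ultimately show ?thesis
      by (simp add: c.add blinfun.add_right inner_add_left inner_add_right B)
  qed
  have P: "quadratic_polar (perturbation p) X Y = rate p X"
    unfolding quadratic_polar_def X Y perturbation_def rate_def prod.case add_Pair Pu Pv Pc
    by (simp add: field_simps)
  have "quadratic_polar (Heps_form S i C Cinv p \<epsilon>) X Y =
      quadratic_polar (H0_form C) X Y + \<epsilon> * quadratic_polar (perturbation p) X Y"
    by (simp add: quadratic_polar_def Heps_form_eq right_diff_distrib distrib_left)
  then show ?thesis unfolding H0 P by (simp add: X)
qed

text \<open>\<open>H0_form\<close> is equivalent to the squared norm and the perturbation is bounded
  by a multiple of it, so the equivalence survives for small \<epsilon>. The derivative is at most a
  negative multiple of the same squared norm.\<close>

lemma Heps_strict_liapunov:
  assumes "p > 1"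
  shows "\<exists>\<epsilon>0>0. \<forall>\<epsilon>. 0 < \<epsilon> \<and> \<epsilon> < \<epsilon>0 \<longrightarrow> strict_liapunov S i C (Heps_form S i C Cinv p \<epsilon>)"
proof -
  define g where "g = 1 - norm C"
  have g: "0 < g" using norm_C by (simp add: g_def)
  obtain M where M: "0 \<le> M" "\<And>X. \<bar>perturbation p X\<bar> \<le> M * (norm X)\<^sup>2"
    using continuous_quadratic_form_bound[OF continuous_quadratic_form_perturbation] by blast
  obtain N c where c: "0 < c" "0 \<le> N" and rate:
    "\<And>u v w z. rate p (u, v, w, z) \<le> N * inner w w - c * ((norm u)\<^sup>2 + (norm v)\<^sup>2 + (norm z)\<^sup>2)"
    by (rule rate_bound[OF assms]) (rule that)
  \<comment> \<open>The first bound gives \<open>\<epsilon> * M \<le> g / 4\<close>, half of the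
    coercivity constant \<open>g / 2\<close> of \<open>H0_form\<close>; the \<open>+ 1\<close>
    guards against \<open>M = 0\<close>. The second gives
    \<open>\<epsilon> * (N + c) \<le> 1\<close>, so the damping absorbs
    \<open>\<epsilon> * N * inner w w\<close> and still leaves
    \<open>- \<epsilon> * c * inner w w\<close>.\<close>
  define \<epsilon>0 where "\<epsilon>0 = min (g / (4 * (M + 1))) (1 / (N + c))"
  have "strict_liapunov S i C (Heps_form S i C Cinv p \<epsilon>)" if \<epsilon>: "0 < \<epsilon>" "\<epsilon> < \<epsilon>0" for \<epsilon>
  proof -
    define Q where "Q = Heps_form S i C Cinv p \<epsilon>"
    define R where "R X = - (case X of (u, v, w, z) \<Rightarrow> inner w w) + \<epsilon> * rate p X" for X :: "('v, 'h) energy"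
    define b where "b = 1 + \<epsilon> * M"
    have \<epsilon>1: "\<epsilon> * M \<le> g / 4" and \<epsilon>2: "\<epsilon> * (N + c) \<le> 1"
    proof -
      have "\<epsilon> * (4 * (M + 1)) \<le> g" using \<epsilon> M(1) by (simp add: \<epsilon>0_def pos_less_divide_eq)
      then show "\<epsilon> * M \<le> g / 4" using \<epsilon>(1) by (simp add: algebra_simps)
      show "\<epsilon> * (N + c) \<le> 1" using \<epsilon> c by (simp add: \<epsilon>0_def pos_less_divide_eq)
    qed
    have b: "0 < b" using \<epsilon>(1) M(1) by (simp add: b_def add_pos_nonneg)
    have Q: "continuous_quadratic_form Q"
      unfolding Q_def Heps_form_eq[abs_def]
      by (intro continuous_quadratic_form_intros continuous_quadratic_form_H0
          continuous_quadratic_form_perturbation)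
    have "continuous_quadratic_form (\<lambda>X. \<epsilon> * rate p X - (case X of (u, v, w, z) \<Rightarrow> inner w w))"
      unfolding case_prod_beta
      by (intro continuous_quadratic_form_intros continuous_quadratic_form_rate bounded_linear_energy_intros)
    then have R: "continuous_quadratic_form R"
      by (simp add: R_def[abs_def])
    have bounds: "g / 4 * (norm X)\<^sup>2 \<le> Q X" "Q X \<le> b * (norm X)\<^sup>2" for X
    proof -
      have "\<bar>\<epsilon> * perturbation p X\<bar> \<le> \<epsilon> * M * (norm X)\<^sup>2"
        using \<epsilon>(1) M(2)[of X] by (simp add: abs_mult)
      moreover from this have "\<bar>\<epsilon> * perturbation p X\<bar> \<le> g / 4 * (norm X)\<^sup>2"
        using mult_right_mono[OF \<epsilon>1, of "(norm X)\<^sup>2"] by simp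
      ultimately show "g / 4 * (norm X)\<^sup>2 \<le> Q X" "Q X \<le> b * (norm X)\<^sup>2"
        using H0_form_bounds[of X]
        unfolding Q_def Heps_form_eq b_def g_def distrib_right
        by (auto simp: abs_le_iff field_simps)
    qed
    have R_le: "R X \<le> - (\<epsilon> * c) * (norm X)\<^sup>2" for X
    proof -
      obtain u v w z where X: "X = (u, v, w, z)" by (cases X) auto
      have "\<epsilon> * rate p X \<le> \<epsilon> * (N * inner w w - c * ((norm u)\<^sup>2 + (norm v)\<^sup>2 + (norm z)\<^sup>2))"
        using \<epsilon>(1) rate by (auto simp: X)
      moreover have "\<epsilon> * (N + c) * inner w w \<le> 1 * inner w w"
        using \<epsilon>2 by (rule mult_right_mono) simp
      ultimately show ?thesis
        unfolding X norm_energy by (simp add: R_def algebra_simps power2_norm_eq_inner)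
    qed
    \<comment> \<open>The rate \<open>\<epsilon> * c / b\<close> comes from comparing
      \<open>R_le\<close> with the upper bound \<open>b\<close> for \<open>Q\<close>.\<close>
    have "\<exists>q'. C1_halfline (\<lambda>t. Q (U t)) q' \<and> (\<forall>t\<ge>0. q' t \<le> - (\<epsilon> * c / b) * Q (U t))"
      if U: "is_solution S i C U" for U
    proof (intro exI conjI allI impI)
      have contU: "continuous_on {0..} U"
        and dU: "\<And>t. 0 \<le> t \<Longrightarrow> ((\<lambda>t. to_weak i (U t)) has_vector_derivative system_rhs S i C (U t)) (at t within {0..})"
        using U by (auto simp: is_solution_def C1_halfline_def)
      have "continuous_on {0..} (\<lambda>t. R (U t))"
        by (rule continuous_quadratic_form_continuous_on[OF R contU])
      moreover have "((\<lambda>t. Q (U t)) has_vector_derivative R (U t)) (at t within {0..})" if "0 \<le> t" for t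
        using bounded_linear_to_weak bounded_linear_system_rhs contU dU Q R _ that
        by (rule weak_solution_quadratic_form_derivative) (simp_all add: Q_def R_def Heps_polar)
      ultimately show "C1_halfline (\<lambda>t. Q (U t)) (\<lambda>t. R (U t))"
        by (simp add: C1_halfline_def)
      fix t :: real
      have "\<epsilon> * c / b * Q (U t) \<le> \<epsilon> * c / b * (b * (norm (U t))\<^sup>2)"
        using bounds(2) \<epsilon> c b by (intro mult_left_mono) auto
      then show "R (U t) \<le> - (\<epsilon> * c / b) * Q (U t)"
        using R_le[of "U t"] b by simp
    qed
    moreover have "0 < \<epsilon> * c / b" using \<epsilon>(1) c(1) b by simp
    moreover have "0 < g / 4" using g by simp
    ultimately have "strict_liapunov S i C Q"
      unfolding strict_liapunov_def using Q bounds b by blast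
    then show ?thesis by (simp add: Q_def)
  qed
  moreover have "0 < \<epsilon>0" using g M(1) c by (simp add: \<epsilon>0_def)
  ultimately show ?thesis by blast
qed

section \<open>From a strict Liapunov functional to exponential damping\<close>

lemma is_solution_add_scaleR:
  assumes "is_solution S i C U" "is_solution S i C V"
  shows "is_solution S i C (\<lambda>t. U t + r *\<^sub>R V t)"
proof -
  interpret J: bounded_linear "to_weak i" by (rule bounded_linear_to_weak)
  interpret L: bounded_linear "system_rhs S i C" by (rule bounded_linear_system_rhs)
  show ?thesis
    unfolding is_solution_def C1_halfline_def J.add J.scaleR L.add L.scaleR
  proof (intro conjI allI impI)
    show "continuous_on {0..} (\<lambda>t. U t + r *\<^sub>R V t)"
      "continuous_on {0..} (\<lambda>t. system_rhs S i C (U t) + r *\<^sub>R system_rhs S i C (V t))"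
      using assms unfolding is_solution_def C1_halfline_def
      by (simp_all add: continuous_on_add continuous_on_scaleR continuous_on_const)
    fix t :: real assume "0 \<le> t"
    then show "((\<lambda>t. to_weak i (U t) + r *\<^sub>R to_weak i (V t)) has_vector_derivative
        system_rhs S i C (U t) + r *\<^sub>R system_rhs S i C (V t)) (at t within {0..})"
      using assms unfolding is_solution_def C1_halfline_def
      by (intro has_vector_derivative_add bounded_linear.has_vector_derivative[OF bounded_linear_scaleR_right])
        simp_all
  qed
qed

text \<open>\<open>Q\<close> is comparable to the squared norm, so solutions decay at half its rate.
  The decay also forces solutions with zero initial data to vanish, and superposition then makes
  each \<open>T t\<close> linear.\<close>

lemma exponentially_damped_if_strict_liapunov:
  assumes Q: "strict_liapunov S i C Q" and T: "is_generated_semigroup S i C T"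
  shows "exponentially_damped T"
proof -
  obtain a b \<delta> where ab: "0 < a" "0 < b" "\<And>X. a * (norm X)\<^sup>2 \<le> Q X" "\<And>X. Q X \<le> b * (norm X)\<^sup>2"
    and \<delta>: "0 < \<delta>" "\<And>U. is_solution S i C U \<Longrightarrow>
        \<exists>q'. C1_halfline (\<lambda>t. Q (U t)) q' \<and> (\<forall>t\<ge>0. q' t \<le> - \<delta> * Q (U t))"
    using Q unfolding strict_liapunov_def by metis
  define M where "M = max 1 (sqrt (b / a))"
  have decay: "norm (U t) \<le> M * exp (- (\<delta> / 2) * t) * norm (U 0)"
    if U: "is_solution S i C U" and t: "0 \<le> t" for U t
  proof -
    obtain q' where q': "C1_halfline (\<lambda>t. Q (U t)) q'" "\<And>t. t \<ge> 0 \<Longrightarrow> q' t \<le> - \<delta> * Q (U t)"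
      using \<delta>(2)[OF U] by blast
    have "a * (norm (U t))\<^sup>2 \<le> Q (U t)" by (rule ab)
    also have "Q (U t) \<le> Q (U 0) * exp (- \<delta> * t)"
      using q' t by (intro exponential_decay[where q' = q']) (auto simp: C1_halfline_def)
    also have "\<dots> \<le> b * (norm (U 0))\<^sup>2 * exp (- \<delta> * t)"
      by (intro mult_right_mono ab) simp
    finally have "(norm (U t))\<^sup>2 \<le> b / a * exp (- \<delta> * t) * (norm (U 0))\<^sup>2"
      using ab(1) by (simp add: field_simps)
    also have "\<dots> = (sqrt (b / a) * exp (- (\<delta> / 2) * t) * norm (U 0))\<^sup>2"
      using ab by (simp add: power_mult_distrib exp_double[symmetric])
    finally have "norm (U t) \<le> sqrt (b / a) * exp (- (\<delta> / 2) * t) * norm (U 0)"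
      by (rule power2_le_imp_le) (use ab in auto)
    also have "\<dots> \<le> M * exp (- (\<delta> / 2) * t) * norm (U 0)"
      by (intro mult_right_mono) (auto simp: M_def)
    finally show ?thesis .
  qed
  have T0: "T 0 X = X" and Tsol: "is_solution S i C (\<lambda>t. T t X)" for X
    using T unfolding is_generated_semigroup_def by blast+
  have zero: "U t = 0" if "is_solution S i C U" "U 0 = 0" "0 \<le> t" for U t
    using decay[OF that(1,3)] that(2) by simp
  have "bounded_linear (T t) \<and> onorm (T t) \<le> M * exp (- (\<delta> / 2) * t)" if t: "0 \<le> t" for t
  proof
    have bound: "norm (T t X) \<le> M * exp (- (\<delta> / 2) * t) * norm X" for X
      using decay[OF Tsol t, of X] by (simp add: T0)
    show "bounded_linear (T t)"
    proof (rule bounded_linear_intro)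
      fix X Y r
      \<comment> \<open>This combination of solutions starts at 0.\<close>
      have "T t (X + Y) + (-1) *\<^sub>R T t X + (-1) *\<^sub>R T t Y = 0"
        by (rule zero[OF is_solution_add_scaleR[OF is_solution_add_scaleR[OF Tsol Tsol] Tsol] _ t])
          (simp add: T0)
      then show "T t (X + Y) = T t X + T t Y" by (simp add: algebra_simps)
      have "T t (r *\<^sub>R X) + (- r) *\<^sub>R T t X = 0"
        by (rule zero[OF is_solution_add_scaleR[OF Tsol Tsol] _ t]) (simp add: T0)
      then show "T t (r *\<^sub>R X) = r *\<^sub>R T t X" by (simp add: algebra_simps)
      show "norm (T t X) \<le> norm X * (M * exp (- (\<delta> / 2) * t))"
        using bound by (simp add: mult_ac)
    qed
    show "onorm (T t) \<le> M * exp (- (\<delta> / 2) * t)"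
      using bound by (intro onorm_bound) (auto simp: M_def)
  qed
  moreover have "1 \<le> M" "0 < \<delta> / 2" using \<delta>(1) by (auto simp: M_def)
  ultimately show ?thesis
    unfolding exponentially_damped_def by blast
qed

end

section \<open>Derivation of the operator identities from the hypotheses, and conclusion\<close>

theorem theorem5p2:
  fixes DA DS :: "'h::{real_inner, complete_space} set"
    and A S :: "'h \<Rightarrow> 'h"
    and i :: "'v::{real_inner, complete_space} \<Rightarrow> 'h"
    and C :: "'v \<Rightarrow>\<^sub>L ('v \<Rightarrow>\<^sub>L real)"
    and Cinv :: "('v \<Rightarrow>\<^sub>L real) \<Rightarrow>\<^sub>L 'h"
  assumes separable: "separable_space (euclidean :: 'h topology)"
    and A: "self_adjoint DA A" "positive_coercive DA A"
    and S: "is_square_root DA A DS S"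
    and V: "is_form_space DS S i"
    and C: "norm C < 1"
    and a: "\<forall>v. C v = 0 \<longrightarrow> v = 0" "range (to_dual i) \<subseteq> range C" "bounded_linear (Cinv_H i C)"
    and b: "inj Cinv" "\<forall>v. Cinv (C v) = i v"
    and c: "\<exists>K\<ge>0. \<forall>u. \<exists>h.
      A_ext S i (Cinv_H i C (i u)) - to_dual i (Cinv (A_ext S i u)) = to_dual i h \<and>
      norm h \<le> K * norm (i u)"
  shows "(\<forall>p>1. \<exists>\<epsilon>0>0. \<forall>\<epsilon>. 0 < \<epsilon> \<and> \<epsilon> < \<epsilon>0 \<longrightarrow>
            strict_liapunov S i C (Heps_form S i C Cinv p \<epsilon>)) \<and>
         (\<forall>T. is_generated_semigroup S i C T \<longrightarrow> exponentially_damped T)"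
proof -
  have i: "bounded_linear i" and "range i = DS" and norm_i: "\<And>u. norm u = norm (S (i u))"
    using V by (auto simp: is_form_space_def)
  have "closure DS = UNIV" and S_add: "\<And>x y. x \<in> DS \<Longrightarrow> y \<in> DS \<Longrightarrow> S (x + y) = S x + S y"
    using S by (auto simp: is_square_root_def self_adjoint_def linear_operator_def)
  then have dense: "closure (range i) = UNIV" and Si_add: "\<And>u v. S (i u + i v) = S (i u) + S (i v)"
    using \<open>range i = DS\<close> by auto
  interpret i: bounded_linear i by (rule i)
  interpret c: bounded_linear "Cinv_H i C" by (rule a(3))
  interpret d: bounded_linear "to_dual i" by (rule bounded_linear_to_dual[OF i])
  \<comment> \<open>Polarization: \<open>S\<close> is additive on \<open>DS\<close> and
    \<open>norm u = norm (S (i u))\<close>, so both forms come from the same norm.\<close>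
  have A_inner: "A_ext S i u v = inner u v" for u v
    by (simp add: A_ext_apply[OF S V] dot_norm norm_i i.add Si_add)
  obtain K f where f: "\<And>u. A_ext S i (Cinv_H i C (i u)) - to_dual i (Cinv (A_ext S i u)) = to_dual i (f u)"
      "\<And>u. norm (f u) \<le> K * norm (i u)"
    using c by metis
  \<comment> \<open>\<open>f\<close> is chosen pointwise, but its image under the injective linear
    map \<open>to_dual i\<close> is linear in \<open>u\<close>.\<close>
  have "linear f"
  proof (rule linearI; rule to_dual_inj[OF i dense])
    show "to_dual i (f (u + v)) = to_dual i (f u + f v)" for u v
      unfolding d.add f(1)[symmetric] by (simp add: i.add c.add d.add blinfun.bilinear_simps)
    show "to_dual i (f (r *\<^sub>R u)) = to_dual i (r *\<^sub>R f u)" for r u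
      unfolding d.scaleR f(1)[symmetric]
      by (simp add: i.scaleR c.scaleR d.scaleR blinfun.bilinear_simps scaleR_diff_right)
  qed
  from extend_from_dense_range[OF i.linear dense this f(2)]
  obtain B where B: "bounded_linear B" "\<And>u. B (i u) = f u" by blast
  interpret coupled_system S i C Cinv B
  proof (rule coupled_system.intro)
    show "C (Cinv_H i C h) = to_dual i h" for h
      unfolding Cinv_H_def using a(2) by (intro f_inv_into_f) auto
    show "A_ext S i (Cinv_H i C (i u)) v - inner (Cinv (A_ext S i u)) (i v) = inner (B (i u)) (i v)" for u v
      using arg_cong[OF f(1)[of u], of "\<lambda>g. blinfun_apply g v"]
      by (simp add: B(2) blinfun.bilinear_simps to_dual_apply[OF i])
  qed (use i A_inner C a(3) b(2) B(1) in auto)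
  have "exponentially_damped T" if "is_generated_semigroup S i C T" for T
  proof -
    \<comment> \<open>Damping does not involve \<open>p\<close> or \<epsilon>, so one admissible
      pair is enough: \<open>p = 2\<close> and half of the threshold.\<close>
    obtain \<epsilon>0 :: real where "0 < \<epsilon>0"
      and "\<And>\<epsilon>. 0 < \<epsilon> \<Longrightarrow> \<epsilon> < \<epsilon>0 \<Longrightarrow> strict_liapunov S i C (Heps_form S i C Cinv 2 \<epsilon>)"
      using Heps_strict_liapunov[of 2] by auto
    then have "strict_liapunov S i C (Heps_form S i C Cinv 2 (\<epsilon>0 / 2))" by simp
    then show ?thesis using that by (rule exponentially_damped_if_strict_liapunov)
  qed
  then show ?thesis using Heps_strict_liapunov by blast
qed

end
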